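(* Let $\mu$ and $\nu$ be probability measures on $\mathbb{R}$ with finite moments of all orders, and let $\mu\vdash\nu$ be their orthogonal convolution. Then the reciprocal Cauchy transform of $\mu\vdash\nu$ is given by $$F_{\mu\vdash\nu}(z)=F_\mu(F_\nu(z))-F_\nu(z)+z,$$ as an identity of formal power series (in $z^{-1}$, with leading term $z$).
   Context: For a distribution $\mu$ with moments $\mu(n)$, $n\ge 0$, $\mu(0)=1$ (i.e. a normalized linear functional on $\mathbb{C}[X]$), put $G_\mu(z)=\sum_{n\ge0}\mu(n)z^{-n-1}$ and $F_\mu(z)=1/G_\mu(z)$ as formal series; $F_\mu(z)-z$ is a formal power series in $z^{-1}$, and $F_\mu(F_\nu(z))$ means substitution of $F_\nu(z)$ for the variable (so $z^{-1}$ is replaced by $G_\nu(z)$). Orthogonality: let $\mathcal A$ be a unital complex algebra with normalized linear functionals $\varphi,\psi$ ($\varphi(1)=\psi(1)=1$), and $\mathcal A_1,\mathcal A_2$ (not necessarily unital) subalgebras. $\mathcal A_2$ is orthogonal to $\mathcal A_1$ with respect to $(\varphi,\psi)$ if (i) $\varphi(bw)=\varphi(wb)=0$ and (ii) $\varphi(w_1a_1ba_2w_2)=\psi(b)\bigl(\varphi(w_1a_1a_2w_2)-\varphi(w_1a_1)\varphi(a_2w_2)\bigr)$ for all $a_1,a_2\in\mathcal A_1$, $b\in\mathcal A_2$ and all $w,w_1,w_2$ in the algebra generated by $\mathcal A_1,\mathcal A_2$ and $1$. A pair $(a,b)$ of elements of $\mathcal A$ is orthogonal w.r.t. $(\varphi,\psi)$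 if the non-unital algebra generated by $b$ is orthogonal to the non-unital algebra generated by $a$. Orthogonal convolution: if $(a,b)$ is orthogonal w.r.t. $(\varphi,\psi)$, with $\mu(n)=\varphi(a^n)$ and $\nu(n)=\psi(b^n)$ for all $n$, then $\mu\vdash\nu$ is the $\varphi$-distribution of $a+b$, i.e. $(\mu\vdash\nu)(n)=\varphi((a+b)^n)$; it depends only on $\mu$ and $\nu$. *)

theory Defs
  imports
    "HOL-Probability.Probability"
    "HOL-Library.Poly_Mapping"
    "HOL-Computational_Algebra.Formal_Laurent_Series"
begin

section \<open>Unital complex algebras and normalized functionals\<close>

class complex_algebra_1 = ring_1 +
  fixes scaleC :: "complex \<Rightarrow> 'a \<Rightarrow> 'a" (infixr \<open>*\<^sub>C\<close> 75)
  assumes scaleC_add_right: "c *\<^sub>C (x + y) = c *\<^sub>C x + c *\<^sub>C y"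
    and scaleC_add_left: "(c + d) *\<^sub>C x = c *\<^sub>C x + d *\<^sub>C x"
    and scaleC_scaleC: "c *\<^sub>C (d *\<^sub>C x) = (c * d) *\<^sub>C x"
    and scaleC_one: "1 *\<^sub>C x = x"
    and mult_scaleC_left: "(c *\<^sub>C x) * y = c *\<^sub>C (x * y)"
    and mult_scaleC_right: "x * (c *\<^sub>C y) = c *\<^sub>C (x * y)"

lemma vector_space_scaleC:
  "vector_space (scaleC :: complex \<Rightarrow> 'a::complex_algebra_1 \<Rightarrow> 'a)"
  by unfold_locales (simp_all add: scaleC_add_right scaleC_add_left scaleC_scaleC scaleC_one)

definition normalized_functional :: "('a::complex_algebra_1 \<Rightarrow> complex) \<Rightarrow> bool" where
  "normalized_functional \<phi> \<longleftrightarrow> Vector_Spaces.linear scaleC (*) \<phi> \<and> \<phi> 1 = 1"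

text \<open>The non-unital subalgebra generated by a set.\<close>

inductive_set alg_gen :: "'a::complex_algebra_1 set \<Rightarrow> 'a set" for S where
  alg_gen_base: "x \<in> S \<Longrightarrow> x \<in> alg_gen S"
| alg_gen_zero: "0 \<in> alg_gen S"
| alg_gen_add: "x \<in> alg_gen S \<Longrightarrow> y \<in> alg_gen S \<Longrightarrow> x + y \<in> alg_gen S"
| alg_gen_mult: "x \<in> alg_gen S \<Longrightarrow> y \<in> alg_gen S \<Longrightarrow> x * y \<in> alg_gen S"
| alg_gen_scale: "x \<in> alg_gen S \<Longrightarrow> c *\<^sub>C x \<in> alg_gen S"


section \<open>Orthogonality and orthogonal convolution\<close>

text \<open>\<open>orthogonal_wrt \<phi> \<psi> A1 A2\<close>: the subalgebra \<open>A2\<close> is orthogonal to the subalgebra \<open>A1\<close>.\<close>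

definition orthogonal_wrt ::
    "('a::complex_algebra_1 \<Rightarrow> complex) \<Rightarrow> ('a \<Rightarrow> complex) \<Rightarrow> 'a set \<Rightarrow> 'a set \<Rightarrow> bool" where
  "orthogonal_wrt \<phi> \<psi> A1 A2 \<longleftrightarrow>
     (\<forall>b\<in>A2. \<forall>w\<in>alg_gen (A1 \<union> A2 \<union> {1}). \<phi> (b * w) = 0 \<and> \<phi> (w * b) = 0) \<and>
     (\<forall>a1\<in>A1. \<forall>a2\<in>A1. \<forall>b\<in>A2.
        \<forall>w1\<in>alg_gen (A1 \<union> A2 \<union> {1}). \<forall>w2\<in>alg_gen (A1 \<union> A2 \<union> {1}).
          \<phi> (w1 * a1 * b * a2 * w2) =
            \<psi> b * (\<phi> (w1 * a1 * a2 * w2) - \<phi> (w1 * a1) * \<phi> (a2 * w2)))"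

definition orthogonal_pair ::
    "('a::complex_algebra_1 \<Rightarrow> complex) \<Rightarrow> ('a \<Rightarrow> complex) \<Rightarrow> 'a \<Rightarrow> 'a \<Rightarrow> bool" where
  "orthogonal_pair \<phi> \<psi> a b \<longleftrightarrow> orthogonal_wrt \<phi> \<psi> (alg_gen {a}) (alg_gen {b})"

text \<open>A distribution is represented by its sequence of moments.\<close>

definition distribution_of :: "('a::complex_algebra_1 \<Rightarrow> complex) \<Rightarrow> 'a \<Rightarrow> nat \<Rightarrow> complex" where
  "distribution_of \<phi> a = (\<lambda>n. \<phi> (a ^ n))"

text \<open>
  A definition cannot quantify over all algebras, that is, over types. It is enough to consider
  orthogonal pairs in the free unital algebra on two generators, the monoid algebra of the words in
  two letters. The theorems \<open>orthogonal_convolution_unique\<close> and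
  \<open>distribution_of_add_orthogonal\<close> below show that such a pair exists for any two
  distributions, and that the resulting distribution is the one obtained from every
  orthogonal pair in every unital complex algebra.
\<close>

datatype letter = Letter_a | Letter_b

datatype free_word = Word "letter list"

instantiation free_word :: monoid_add
begin

definition "0 = Word []"

fun plus_free_word :: "free_word \<Rightarrow> free_word \<Rightarrow> free_word" where
  "Word u + Word v = Word (u @ v)"

instance
proof
  fix x y z :: free_word
  show "x + y + z = x + (y + z)" by (cases x; cases y; cases z) simp
  show "0 + x = x" "x + 0 = x" by (cases x; simp add: zero_free_word_def)+
qed

end

instantiation complex :: complex_algebra_1
begin

definition "scaleC_complex = ((*) :: complex \<Rightarrow> complex \<Rightarrow> complex)"

instance by standard (simp_all add: scaleC_complex_def algebra_simps)

end


lemma poly_mapping_add_single_induct [case_names zero single add]: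
  assumes "P 0" and "\<And>k v. P (Poly_Mapping.single k v)" and "\<And>p q. P p \<Longrightarrow> P q \<Longrightarrow> P (p + q)"
  shows "P (p :: 'a \<Rightarrow>\<^sub>0 'b::comm_monoid_add)"
proof (induction p rule: update_induct)
  case const
  show ?case by fact
next
  case (update f k v)
  have "Poly_Mapping.update k v f = Poly_Mapping.single k v + f"
    using update.hyps
    by (intro poly_mapping_eqI)
      (auto simp: lookup_update lookup_add lookup_single in_keys_iff when_def)
  then show ?case using assms update by simp
qed

lemma scaleC_zero_right: "c *\<^sub>C (0 :: 'a::complex_algebra_1) = 0"
  using scaleC_add_right[of c 0 0] by simp

instantiation poly_mapping :: (monoid_add, complex_algebra_1) complex_algebra_1
begin

definition scaleC_poly_mapping :: "complex \<Rightarrow> ('a \<Rightarrow>\<^sub>0 'b) \<Rightarrow> ('a \<Rightarrow>\<^sub>0 'b)" where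
  "c *\<^sub>C p = Poly_Mapping.map (scaleC c) p"

lemma lookup_scaleC: "Poly_Mapping.lookup (c *\<^sub>C p) x = c *\<^sub>C Poly_Mapping.lookup p x"
  for p :: "'a \<Rightarrow>\<^sub>0 'b"
  by (simp add: scaleC_poly_mapping_def Poly_Mapping.map.rep_eq when_def scaleC_zero_right)

lemma scaleC_single: "c *\<^sub>C Poly_Mapping.single k v = Poly_Mapping.single k (c *\<^sub>C v)"
  for v :: 'b and k :: 'a
  by (rule poly_mapping_eqI) (simp add: lookup_scaleC lookup_single when_def scaleC_zero_right)

instance
proof
  fix c d :: complex and p q :: "'a \<Rightarrow>\<^sub>0 'b"
  show dist: "c *\<^sub>C (p + q) = c *\<^sub>C p + c *\<^sub>C q" for p q :: "'a \<Rightarrow>\<^sub>0 'b"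
    by (rule poly_mapping_eqI) (simp add: lookup_scaleC lookup_add scaleC_add_right)
  show "(c + d) *\<^sub>C p = c *\<^sub>C p + d *\<^sub>C p"
    by (rule poly_mapping_eqI) (simp add: lookup_scaleC lookup_add scaleC_add_left)
  show "c *\<^sub>C (d *\<^sub>C p) = (c * d) *\<^sub>C p"
    by (rule poly_mapping_eqI) (simp add: lookup_scaleC scaleC_scaleC)
  show "1 *\<^sub>C p = p"
    by (rule poly_mapping_eqI) (simp add: lookup_scaleC scaleC_one)
  have zero: "c *\<^sub>C (0 :: 'a \<Rightarrow>\<^sub>0 'b) = 0"
    by (rule poly_mapping_eqI) (simp add: lookup_scaleC scaleC_zero_right)
  have "Poly_Mapping.single k v * (c *\<^sub>C q) = c *\<^sub>C (Poly_Mapping.single k v * q)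
      \<and> (c *\<^sub>C Poly_Mapping.single k v) * q = c *\<^sub>C (Poly_Mapping.single k v * q)" for k v
    by (induction q rule: poly_mapping_add_single_induct)
      (simp_all add: zero scaleC_single mult_single mult_scaleC_left mult_scaleC_right
        distrib_left dist)
  note single = this
  show "(c *\<^sub>C p) * q = c *\<^sub>C (p * q)"
    by (induction p rule: poly_mapping_add_single_induct)
      (simp_all add: zero single dist distrib_right)
  show "p * (c *\<^sub>C q) = c *\<^sub>C (p * q)"
    by (induction p rule: poly_mapping_add_single_induct)
      (simp_all add: zero single dist distrib_right)
qed

end

type_synonym free_algebra = "free_word \<Rightarrow>\<^sub>0 complex"

definition is_orthogonal_convolution ::
    "(nat \<Rightarrow> complex) \<Rightarrow> (nat \<Rightarrow> complex) \<Rightarrow> (nat \<Rightarrow> complex) \<Rightarrow> bool" where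
  "is_orthogonal_convolution m v r \<longleftrightarrow>
     (\<exists>(\<phi> :: free_algebra \<Rightarrow> complex) \<psi> a b.
        normalized_functional \<phi> \<and> normalized_functional \<psi> \<and> orthogonal_pair \<phi> \<psi> a b \<and>
        distribution_of \<phi> a = m \<and> distribution_of \<psi> b = v \<and> distribution_of \<phi> (a + b) = r)"

definition orthogonal_convolution ::
    "(nat \<Rightarrow> complex) \<Rightarrow> (nat \<Rightarrow> complex) \<Rightarrow> nat \<Rightarrow> complex" (infixl \<open>\<turnstile>\<close> 65) where
  "m \<turnstile> v = (THE r. is_orthogonal_convolution m v r)"


subsection \<open>The orthogonal convolution is well defined\<close>

lemma normalized_functionalD:
  assumes "normalized_functional \<phi>"
  shows "\<phi> (x + y) = \<phi> x + \<phi> y" "\<phi> (c *\<^sub>C x) = c * \<phi> x" "\<phi> 0 = 0" "\<phi> 1 = 1"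
proof -
  have lin: "Vector_Spaces.linear scaleC (*) \<phi>" and one: "\<phi> 1 = 1"
    using assms by (auto simp: normalized_functional_def)
  interpret Vector_Spaces.linear scaleC "(*)" \<phi> by (rule lin)
  show "\<phi> (x + y) = \<phi> x + \<phi> y" "\<phi> (c *\<^sub>C x) = c * \<phi> x" "\<phi> 0 = 0" "\<phi> 1 = 1"
    by (simp_all add: add scale zero one)
qed

lemma alg_gen_power_Suc: "x \<in> alg_gen S \<Longrightarrow> x ^ Suc n \<in> alg_gen S"
  by (induction n) (auto intro: alg_gen.intros simp del: power_Suc simp: power_Suc[of _ "Suc _"])

lemma alg_gen_one_power: "1 \<in> alg_gen S \<Longrightarrow> x \<in> alg_gen S \<Longrightarrow> x ^ n \<in> alg_gen S"
  by (induction n) (auto intro: alg_gen.intros)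

lemma power_add_expand:
  fixes a b :: "'a::ring_1"
  shows "(a + b) ^ n = (\<Sum>j<n. b ^ j * a * (a + b) ^ (n - 1 - j)) + b ^ n"
proof (induction n)
  case (Suc n)
  have "(a + b) ^ Suc n = a * (a + b) ^ n + b * (a + b) ^ n"
    by (simp add: algebra_simps)
  also have "b * (a + b) ^ n = (\<Sum>j<n. b ^ Suc j * a * (a + b) ^ (n - 1 - j)) + b ^ Suc n"
    by (subst Suc.IH) (simp add: algebra_simps sum_distrib_left)
  also have "a * (a + b) ^ n + \<dots> = (\<Sum>j<Suc n. b ^ j * a * (a + b) ^ (Suc n - 1 - j)) + b ^ Suc n"
    by (subst sum.lessThan_Suc_shift) simp
  finally show ?case .
qed simp

lemma orthogonal_pair_recurrence:
  fixes a b :: "'a::complex_algebra_1"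
  assumes nf: "normalized_functional \<phi>" and orth: "orthogonal_pair \<phi> \<psi> a b"
  shows "\<phi> ((a + b) ^ Suc n) = \<phi> (a * (a + b) ^ n)"
    and "\<phi> (a ^ Suc k * (a + b) ^ Suc n) =
      (\<Sum>j<Suc n. if j = 0 then \<phi> (a ^ Suc (Suc k) * (a + b) ^ n)
         else \<psi> (b ^ j) * (\<phi> (a ^ Suc (Suc k) * (a + b) ^ (n - j))
                 - \<phi> (a ^ Suc k) * \<phi> (a * (a + b) ^ (n - j))))"
proof -
  define W where "W = alg_gen (alg_gen {a} \<union> alg_gen {b} \<union> {1})"
  have W1: "1 \<in> W" unfolding W_def by (auto intro: alg_gen.intros)
  have Wa: "a \<in> W" and Wb: "b \<in> W" unfolding W_def by (auto intro: alg_gen.intros)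
  have Wp: "x ^ i \<in> W" if "x \<in> W" for x i
    using alg_gen_one_power that W1 unfolding W_def by blast
  have Ws: "(a + b) ^ i \<in> W" for i
    using Wp[OF alg_gen_add[OF Wa[unfolded W_def] Wb[unfolded W_def], folded W_def]] .
  have pa: "a ^ Suc i \<in> alg_gen {a}" and pb: "b ^ Suc i \<in> alg_gen {b}" for i
    by (rule alg_gen_power_Suc, rule alg_gen_base, simp)+
  have z: "\<phi> (y * w) = 0" "\<phi> (w * y) = 0" if "y \<in> alg_gen {b}" "w \<in> W" for y w
    using orth that unfolding orthogonal_pair_def orthogonal_wrt_def W_def by blast+
  have o: "\<phi> (w1 * a1 * y * a2 * w2) = \<psi> y * (\<phi> (w1 * a1 * a2 * w2) - \<phi> (w1 * a1) * \<phi> (a2 * w2))"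
    if "y \<in> alg_gen {b}" "a1 \<in> alg_gen {a}" "a2 \<in> alg_gen {a}" "w1 \<in> W" "w2 \<in> W" for y a1 a2 w1 w2
    using orth that unfolding orthogonal_pair_def orthogonal_wrt_def W_def by blast
  note lin = normalized_functionalD[OF nf]
  show "\<phi> ((a + b) ^ Suc n) = \<phi> (a * (a + b) ^ n)"
    using z(1)[OF pb[of 0] Ws[of n]] by (simp add: distrib_right lin)
  have lin_sum: "\<phi> (sum f A) = (\<Sum>x\<in>A. \<phi> (f x))" for f :: "nat \<Rightarrow> 'a" and A
    by (induction A rule: infinite_finite_induct) (simp_all add: lin)
  have "\<phi> (a ^ Suc k * (a + b) ^ Suc n) =
      (\<Sum>j<Suc n. \<phi> (a ^ Suc k * b ^ j * a * (a + b) ^ (n - j))) + \<phi> (a ^ Suc k * b ^ Suc n)"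
    by (subst power_add_expand)
      (simp add: distrib_left lin lin_sum sum_distrib_left mult.assoc del: sum.lessThan_Suc power_Suc)
  also have "\<phi> (a ^ Suc k * b ^ Suc n) = 0"
    by (rule z(2)[OF pb Wp[OF Wa]])
  also have "(\<Sum>j<Suc n. \<phi> (a ^ Suc k * b ^ j * a * (a + b) ^ (n - j))) =
      (\<Sum>j<Suc n. if j = 0 then \<phi> (a ^ Suc (Suc k) * (a + b) ^ n)
         else \<psi> (b ^ j) * (\<phi> (a ^ Suc (Suc k) * (a + b) ^ (n - j))
                 - \<phi> (a ^ Suc k) * \<phi> (a * (a + b) ^ (n - j))))"
  proof (rule sum.cong[OF refl])
    fix j
    have "\<phi> (a ^ Suc k * b ^ Suc i * a * (a + b) ^ (n - Suc i)) =
      \<psi> (b ^ Suc i) * (\<phi> (a ^ Suc k * a * (a + b) ^ (n - Suc i))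
         - \<phi> (a ^ Suc k) * \<phi> (a * (a + b) ^ (n - Suc i)))" for i
      using o[OF pb[of i] pa[of k] pa[of 0] W1 Ws[of "n - Suc i"]]
      by (simp add: mult.assoc)
    then show "\<phi> (a ^ Suc k * b ^ j * a * (a + b) ^ (n - j)) =
      (if j = 0 then \<phi> (a ^ Suc (Suc k) * (a + b) ^ n)
         else \<psi> (b ^ j) * (\<phi> (a ^ Suc (Suc k) * (a + b) ^ (n - j))
                 - \<phi> (a ^ Suc k) * \<phi> (a * (a + b) ^ (n - j))))"
      by (cases j) (simp_all only: power_Suc2[of a "Suc k"] power_0 mult_1_right if_True if_False
          nat.distinct diff_zero simp_thms)
  qed
  finally show "\<phi> (a ^ Suc k * (a + b) ^ Suc n) =
      (\<Sum>j<Suc n. if j = 0 then \<phi> (a ^ Suc (Suc k) * (a + b) ^ n)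
         else \<psi> (b ^ j) * (\<phi> (a ^ Suc (Suc k) * (a + b) ^ (n - j))
                 - \<phi> (a ^ Suc k) * \<phi> (a * (a + b) ^ (n - j))))"
    by simp
qed

lemma orthogonal_pairs_same_distribution:
  fixes a b :: "'a::complex_algebra_1" and a' b' :: "'b::complex_algebra_1"
  assumes "normalized_functional \<phi>" "orthogonal_pair \<phi> \<psi> a b"
    and "normalized_functional \<phi>'" "orthogonal_pair \<phi>' \<psi>' a' b'"
    and "distribution_of \<phi> a = distribution_of \<phi>' a'" "distribution_of \<psi> b = distribution_of \<psi>' b'"
  shows "distribution_of \<phi> (a + b) = distribution_of \<phi>' (a' + b')"
proof -
  have m: "\<phi> (a ^ n) = \<phi>' (a' ^ n)" and v: "\<psi> (b ^ n) = \<psi>' (b' ^ n)" for n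
    using assms(5,6) by (auto simp: distribution_of_def fun_eq_iff)
  have eq: "\<phi> (a ^ Suc k * (a + b) ^ n) = \<phi>' (a' ^ Suc k * (a' + b') ^ n)" for k n
  proof (induction n arbitrary: k rule: less_induct)
    case (less n)
    show ?case
    proof (cases n)
      case 0
      then show ?thesis using m[of "Suc k"] by simp
    next
      case (Suc l)
      have "\<phi> (a * (a + b) ^ i) = \<phi>' (a' * (a' + b') ^ i)" if "i \<le> l" for i
        using less.IH[of i 0] that Suc by simp
      moreover have "\<phi> (a ^ Suc (Suc k) * (a + b) ^ i) = \<phi>' (a' ^ Suc (Suc k) * (a' + b') ^ i)"
        if "i \<le> l" for i
        using less.IH[of i "Suc k"] that Suc by simp
      ultimately show ?thesis
        unfolding Suc orthogonal_pair_recurrence(2)[OF assms(1,2)]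
          orthogonal_pair_recurrence(2)[OF assms(3,4)]
        by (intro sum.cong) (simp_all only: m v diff_le_self order_refl split: if_split)
    qed
  qed
  have "\<phi> ((a + b) ^ n) = \<phi>' ((a' + b') ^ n)" for n
  proof (cases n)
    case 0
    then show ?thesis
      using assms(1,3) by (simp add: normalized_functional_def)
  next
    case (Suc l)
    then show ?thesis
      using eq[of 0 l] orthogonal_pair_recurrence(1)[OF assms(1,2)]
        orthogonal_pair_recurrence(1)[OF assms(3,4)] by simp
  qed
  then show ?thesis by (simp add: distribution_of_def fun_eq_iff)
qed


text \<open>
  Existence: on the space of polynomials in two commuting variables \<open>x\<close>, \<open>y\<close>, with functional
  \<open>x\<^sup>k y\<^sup>n \<mapsto> m k * v n\<close>, let \<open>a\<close> be integration over \<open>y\<close> followed by multiplication by \<open>x\<close>, and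
  let \<open>b\<close> be subtraction of the integral over \<open>x\<close> followed by multiplication by \<open>y\<close>. A polynomial
  \<open>p\<close> is recorded below by the values \<open>e k n\<close> of the functional at \<open>x\<^sup>k y\<^sup>n p\<close>.
\<close>

fun model_act ::
    "(nat \<Rightarrow> complex) \<Rightarrow> (nat \<Rightarrow> complex) \<Rightarrow> letter \<Rightarrow> (nat \<Rightarrow> nat \<Rightarrow> complex) \<Rightarrow> nat \<Rightarrow> nat \<Rightarrow> complex"
  where
    "model_act m v Letter_a e = (\<lambda>k n. e (Suc k) 0 * v n)"
  | "model_act m v Letter_b e = (\<lambda>k n. e k (Suc n) - e 0 (Suc n) * m k)"

lemma foldr_model_act_linear:
  "foldr (model_act m v) u (\<lambda>k n. c * e k n + d * e' k n) =
     (\<lambda>k n. c * foldr (model_act m v) u e k n + d * foldr (model_act m v) u e' k n)"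
proof (induction u)
  case (Cons x u)
  then show ?case by (cases x) (simp_all add: algebra_simps)
qed simp

lemma foldr_model_act_a:
  assumes "v 0 = 1"
  shows "foldr (model_act m v) (replicate (Suc i) Letter_a) e = (\<lambda>k n. e (Suc i + k) 0 * v n)"
  using assms by (induction i) simp_all

lemma foldr_model_act_b:
  assumes "m 0 = 1"
  shows "foldr (model_act m v) (replicate (Suc i) Letter_b) e =
    (\<lambda>k n. e k (Suc i + n) - e 0 (Suc i + n) * m k)"
  using assms by (induction i) simp_all

lemma foldr_model_act_zero: "foldr (model_act m v) u (\<lambda>k n. 0) = (\<lambda>k n. 0)"
  using foldr_model_act_linear[of m v u 0 undefined 0 undefined] by simp

definition model_word :: "(nat \<Rightarrow> complex) \<Rightarrow> (nat \<Rightarrow> complex) \<Rightarrow> letter list \<Rightarrow> complex" where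
  "model_word m v u = foldr (model_act m v) u (\<lambda>k n. m k * v n) 0 0"

lemma model_word_b_left:
  assumes "m 0 = 1"
  shows "model_word m v (replicate (Suc i) Letter_b @ u) = 0"
  using assms by (simp add: model_word_def foldr_model_act_b del: replicate.simps foldr_replicate)

lemma model_word_b_right:
  assumes "m 0 = 1"
  shows "model_word m v (u @ replicate (Suc i) Letter_b) = 0"
  using assms by (simp add: model_word_def foldr_model_act_b foldr_model_act_zero del: replicate.simps foldr_replicate)

lemma model_word_a:
  assumes "m 0 = 1" "v 0 = 1"
  shows "model_word m v (replicate i Letter_a) = m i"
proof (cases i)
  case (Suc l)
  then show ?thesis
    using assms by (simp add: model_word_def foldr_model_act_a del: replicate.simps foldr_replicate)
qed (use assms in \<open>simp add: model_word_def\<close>)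

lemma model_word_aba:
  assumes "m 0 = 1" "v 0 = 1"
  shows "model_word m v (w1 @ replicate (Suc i) Letter_a @ replicate (Suc j) Letter_b
            @ replicate (Suc l) Letter_a @ w2) =
    v (Suc j) * (model_word m v (w1 @ replicate (Suc i) Letter_a @ replicate (Suc l) Letter_a @ w2)
      - model_word m v (w1 @ replicate (Suc i) Letter_a) * model_word m v (replicate (Suc l) Letter_a @ w2))"
proof -
  let ?R = "foldr (model_act m v)"
  define e0 where "e0 = (\<lambda>k n. m k * v n)"
  define g where "g k = ?R w2 e0 (Suc l + k) 0" for k
  have 1: "?R (replicate (Suc l) Letter_a) (?R w2 e0) = (\<lambda>k n. g k * v n)"
    using assms by (simp add: foldr_model_act_a g_def del: replicate.simps foldr_replicate)
  have 2: "?R (replicate (Suc i) Letter_a) (?R (replicate (Suc j) Letter_b) (\<lambda>k n. g k * v n)) =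
     (\<lambda>k n. v (Suc j) * ?R (replicate (Suc i) Letter_a) (\<lambda>k n. g k * v n) k n
         + (- v (Suc j) * g 0) * ?R (replicate (Suc i) Letter_a) e0 k n)"
    using assms by (simp add: foldr_model_act_a foldr_model_act_b e0_def algebra_simps del: replicate.simps foldr_replicate)
  show ?thesis
    using assms
    apply (simp add: model_word_def e0_def[symmetric] 1 del: replicate.simps foldr_replicate)
    apply (subst 2, subst foldr_model_act_linear)
    apply (simp add: algebra_simps del: replicate.simps foldr_replicate)
    done
qed

interpretation scaleC: vector_space "scaleC :: complex \<Rightarrow> 'a::complex_algebra_1 \<Rightarrow> 'a"
  by (rule vector_space_scaleC)

lemma alg_gen_singleton_subset_span: "x \<in> alg_gen {c} \<Longrightarrow> x \<in> scaleC.span (range (\<lambda>k. c ^ Suc k))"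
proof (induction rule: alg_gen.induct)
  case (alg_gen_base x)
  then show ?case by (intro scaleC.span_base) (auto intro: image_eqI[of _ _ 0])
next
  case (alg_gen_mult x y)
  have "c ^ Suc i * y \<in> scaleC.span (range (\<lambda>k. c ^ Suc k))" for i
    using alg_gen_mult.IH(2)
  proof (induction rule: scaleC.span_induct_alt)
    case base
    show ?case by (simp add: scaleC.span_zero)
  next
    case (step d s y)
    then obtain j where "s = c ^ Suc j" by auto
    then have "c ^ Suc i * s = c ^ Suc (Suc (i + j))"
      by (simp only: power_add[symmetric] add_Suc add_Suc_right)
    then have "c ^ Suc i * s \<in> scaleC.span (range (\<lambda>k. c ^ Suc k))"
      by (metis rangeI scaleC.span_base)
    then show ?case using step
      by (simp only: distrib_left mult_scaleC_right scaleC.span_add scaleC.span_scale)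
  qed
  note pow = this
  show ?case using alg_gen_mult.IH(1)
  proof (induction rule: scaleC.span_induct_alt)
    case base
    show ?case by (simp add: scaleC.span_zero)
  next
    case (step d s x)
    then show ?case using pow
      by (auto simp only: distrib_right mult_scaleC_left intro!: scaleC.span_add scaleC.span_scale)
  qed
qed (auto intro: scaleC.span_zero scaleC.span_add scaleC.span_scale)

definition free_monomial :: "letter list \<Rightarrow> free_algebra" where
  "free_monomial u = Poly_Mapping.single (Word u) 1"

lemma free_monomial_mult: "free_monomial u * free_monomial w = free_monomial (u @ w)"
  by (simp add: free_monomial_def mult_single)

lemma free_monomial_Nil: "free_monomial [] = 1"
  by (simp add: free_monomial_def flip: zero_free_word_def)

lemma free_monomial_power: "free_monomial [x] ^ n = free_monomial (replicate n x)"
  by (induction n) (simp_all add: free_monomial_Nil free_monomial_mult)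

lemma free_algebra_span: "p \<in> scaleC.span (range free_monomial)"
proof (induction p rule: poly_mapping_add_single_induct)
  case (single k v)
  obtain u where "k = Word u" by (cases k)
  then have "Poly_Mapping.single k v = v *\<^sub>C free_monomial u"
    by (simp add: free_monomial_def scaleC_single scaleC_complex_def)
  then show ?case by (simp add: scaleC.span_scale scaleC.span_base)
qed (auto intro: scaleC.span_zero scaleC.span_add)

definition lin_ext :: "(letter list \<Rightarrow> complex) \<Rightarrow> free_algebra \<Rightarrow> complex" where
  "lin_ext f p = (\<Sum>k\<in>Poly_Mapping.keys p. Poly_Mapping.lookup p k * (case k of Word u \<Rightarrow> f u))"

lemma lin_ext_add: "lin_ext f (p + q) = lin_ext f p + lin_ext f q"
  unfolding lin_ext_def
  by (rule setsum_keys_plus_distrib[where f = "\<lambda>k c. c * (case k of Word u \<Rightarrow> f u)"])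
    (simp_all add: distrib_right)

lemma lin_ext_scale: "lin_ext f (c *\<^sub>C p) = c * lin_ext f p"
proof (cases "c = 0")
  case False
  then have "Poly_Mapping.keys (c *\<^sub>C p) = Poly_Mapping.keys p"
    by (auto simp: in_keys_iff lookup_scaleC scaleC_complex_def)
  then show ?thesis
    by (simp add: lin_ext_def lookup_scaleC scaleC_complex_def sum_distrib_left mult.assoc)
qed (simp add: lin_ext_def)

lemma lin_ext_zero: "lin_ext f 0 = 0"
  by (simp add: lin_ext_def)

lemma lin_ext_monomial: "lin_ext f (free_monomial u) = f u"
  by (simp add: lin_ext_def free_monomial_def)

lemma normalized_functional_lin_ext: "f [] = 1 \<Longrightarrow> normalized_functional (lin_ext f)"
  unfolding normalized_functional_def Vector_Spaces.linear_iff
  by (auto simp: lin_ext_add lin_ext_scale lin_ext_monomial vector_space_scaleC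
      vector_space_over_itself.vector_space_axioms simp flip: free_monomial_Nil)

text \<open>Two linear functionals are equal on a span if they are equal on its generators.\<close>

lemma functional_eq_on_span:
  fixes f g :: "'a::complex_algebra_1 \<Rightarrow> complex"
  assumes "x \<in> scaleC.span S"
    and "\<And>s. s \<in> S \<Longrightarrow> f s = g s"
    and "f 0 = 0" "\<And>c x y. f (c *\<^sub>C x + y) = c * f x + f y"
    and "g 0 = 0" "\<And>c x y. g (c *\<^sub>C x + y) = c * g x + g y"
  shows "f x = g x"
  using assms(1) by (induction rule: scaleC.span_induct_alt) (simp_all add: assms(2-))

theorem orthogonal_convolution_exists:
  assumes m: "m 0 = 1" and v: "v 0 = 1"
  shows "\<exists>r. is_orthogonal_convolution m v r"
proof -
  define \<phi> where "\<phi> = lin_ext (model_word m v)"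
  define \<psi> where "\<psi> = lin_ext (\<lambda>u. if u = replicate (length u) Letter_b then v (length u) else 0)"
  define a where "a = free_monomial [Letter_a]"
  define b where "b = free_monomial [Letter_b]"
  note lin = lin_ext_add lin_ext_scale lin_ext_zero distrib_left distrib_right
    mult_scaleC_left mult_scaleC_right algebra_simps
  note mon = a_def b_def free_monomial_power free_monomial_mult lin_ext_monomial
  have nf: "normalized_functional \<phi>" "normalized_functional \<psi>"
    unfolding \<phi>_def \<psi>_def using m v
    by (auto intro!: normalized_functional_lin_ext simp: model_word_def)
  have spanb: "y \<in> scaleC.span (range (\<lambda>k. b ^ Suc k))" if "y \<in> alg_gen {b}" for y
    by (rule alg_gen_singleton_subset_span) fact
  have spana: "y \<in> scaleC.span (range (\<lambda>k. a ^ Suc k))" if "y \<in> alg_gen {a}" for y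
    by (rule alg_gen_singleton_subset_span) fact
  have z1: "\<phi> (y * w) = 0" if y: "y \<in> alg_gen {b}" for y w
  proof (rule functional_eq_on_span[OF spanb[OF y], where f = "\<lambda>y. \<phi> (y * w)" and g = "\<lambda>_. 0"])
    fix s assume "s \<in> range (\<lambda>k. b ^ Suc k)"
    then obtain i where s: "s = b ^ Suc i" by blast
    show "\<phi> (s * w) = 0"
      by (rule functional_eq_on_span[OF free_algebra_span, where f = "\<lambda>w. \<phi> (s * w)" and g = "\<lambda>_. 0"])
        (auto simp: \<phi>_def s mon model_word_b_left[where m=m and v=v, OF m] lin_ext_zero lin
          simp del: power_Suc replicate.simps)
  qed (simp_all add: \<phi>_def lin)
  have z2: "\<phi> (w * y) = 0" if y: "y \<in> alg_gen {b}" for y w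
  proof (rule functional_eq_on_span[OF spanb[OF y], where f = "\<lambda>y. \<phi> (w * y)" and g = "\<lambda>_. 0"])
    fix s assume "s \<in> range (\<lambda>k. b ^ Suc k)"
    then obtain i where s: "s = b ^ Suc i" by blast
    show "\<phi> (w * s) = 0"
      by (rule functional_eq_on_span[OF free_algebra_span, where f = "\<lambda>w. \<phi> (w * s)" and g = "\<lambda>_. 0"])
        (auto simp: \<phi>_def s mon model_word_b_right[where m=m and v=v, OF m] lin_ext_zero lin
          simp del: power_Suc replicate.simps)
  qed (simp_all add: \<phi>_def lin)
  let ?E = "\<lambda>w1 a1 y a2 w2. \<psi> y * (\<phi> (w1 * a1 * a2 * w2) - \<phi> (w1 * a1) * \<phi> (a2 * w2))"
  have words: "\<phi> (free_monomial u1 * a ^ Suc i * b ^ Suc j * a ^ Suc l * free_monomial u2) =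
      ?E (free_monomial u1) (a ^ Suc i) (b ^ Suc j) (a ^ Suc l) (free_monomial u2)" for u1 u2 i j l
  proof -
    have "\<psi> (b ^ Suc j) = v (Suc j)"
      by (simp add: \<psi>_def mon del: power_Suc replicate.simps)
    then show ?thesis
      using model_word_aba[of m v u1 i j l u2] m v
      by (simp add: \<phi>_def mon del: power_Suc replicate.simps)
  qed
  have o: "\<phi> (w1 * a1 * y * a2 * w2) = ?E w1 a1 y a2 w2"
    if y: "y \<in> alg_gen {b}" and a1: "a1 \<in> alg_gen {a}" and a2: "a2 \<in> alg_gen {a}" for y a1 a2 w1 w2
  proof -
    have 1: "\<phi> (free_monomial u1 * a ^ Suc i * b ^ Suc j * a ^ Suc l * w2) =
      ?E (free_monomial u1) (a ^ Suc i) (b ^ Suc j) (a ^ Suc l) w2" for u1 i j l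
      by (rule functional_eq_on_span[OF free_algebra_span[of w2]])
        (auto simp only: words, simp_all add: \<phi>_def lin del: power_Suc)
    have 2: "\<phi> (w1 * a ^ Suc i * b ^ Suc j * a ^ Suc l * w2) =
      ?E w1 (a ^ Suc i) (b ^ Suc j) (a ^ Suc l) w2" for i j l
      by (rule functional_eq_on_span[OF free_algebra_span[of w1],
            where f = "\<lambda>w1. \<phi> (w1 * a ^ Suc i * b ^ Suc j * a ^ Suc l * w2)"])
        (auto simp only: 1, simp_all add: \<phi>_def lin del: power_Suc)
    have 3: "\<phi> (w1 * a1 * b ^ Suc j * a ^ Suc l * w2) = ?E w1 a1 (b ^ Suc j) (a ^ Suc l) w2" for j l
      by (rule functional_eq_on_span[OF spana[OF a1],
            where f = "\<lambda>a1. \<phi> (w1 * a1 * b ^ Suc j * a ^ Suc l * w2)"])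
        (auto simp only: 2, simp_all add: \<phi>_def lin del: power_Suc)
    have 4: "\<phi> (w1 * a1 * y * a ^ Suc l * w2) = ?E w1 a1 y (a ^ Suc l) w2" for l
      by (rule functional_eq_on_span[OF spanb[OF y],
            where f = "\<lambda>y. \<phi> (w1 * a1 * y * a ^ Suc l * w2)"])
        (auto simp only: 3, simp_all add: \<phi>_def \<psi>_def lin del: power_Suc)
    show ?thesis
      by (rule functional_eq_on_span[OF spana[OF a2],
            where f = "\<lambda>a2. \<phi> (w1 * a1 * y * a2 * w2)"])
        (auto simp only: 4, simp_all add: \<phi>_def lin del: power_Suc)
  qed
  have "orthogonal_pair \<phi> \<psi> a b"
    unfolding orthogonal_pair_def orthogonal_wrt_def using z1 z2 o by blast
  moreover have "distribution_of \<phi> a = m" "distribution_of \<psi> b = v"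
    by (simp_all add: distribution_of_def fun_eq_iff \<phi>_def \<psi>_def mon
        model_word_a[where m=m and v=v, OF m v])
  ultimately show ?thesis
    using nf unfolding is_orthogonal_convolution_def by blast
qed

theorem orthogonal_convolution_unique:
  assumes "m 0 = 1" "v 0 = 1"
  shows "\<exists>!r. is_orthogonal_convolution m v r"
  using orthogonal_convolution_exists[where m=m and v=v, OF assms]
  unfolding is_orthogonal_convolution_def
  using orthogonal_pairs_same_distribution by (metis (lifting))

theorem distribution_of_add_orthogonal:
  fixes a b :: "'a::complex_algebra_1"
  assumes "normalized_functional \<phi>" "normalized_functional \<psi>" "orthogonal_pair \<phi> \<psi> a b"
  shows "distribution_of \<phi> (a + b) = distribution_of \<phi> a \<turnstile> distribution_of \<psi> b"
proof -
  have "distribution_of \<phi> a 0 = 1" "distribution_of \<psi> b 0 = 1"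
    using assms by (simp_all add: distribution_of_def normalized_functional_def)
  then have uniq: "\<exists>!r. is_orthogonal_convolution (distribution_of \<phi> a) (distribution_of \<psi> b) r"
    by (rule orthogonal_convolution_unique)
  obtain r where r: "is_orthogonal_convolution (distribution_of \<phi> a) (distribution_of \<psi> b) r"
    using uniq by blast
  then have "r = distribution_of \<phi> (a + b)"
    unfolding is_orthogonal_convolution_def
    using orthogonal_pairs_same_distribution assms by metis
  then show ?thesis
    unfolding orthogonal_convolution_def using r uniq by (simp add: the1_equality)
qed


section \<open>Reciprocal Cauchy transforms\<close>

text \<open>
  Formal series in \<open>z\<^sup>-\<^sup>1\<close> are Laurent series in the variable \<open>fls_X = z\<^sup>-\<^sup>1\<close>, so that \<open>z\<close> itself
  is \<open>fls_X_inv\<close>. Substituting \<open>F\<^sub>\<nu>(z)\<close> for \<open>z\<close> in a series \<open>H\<close> replaces the variable \<open>z\<^sup>-\<^sup>1\<close> by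
  \<open>1 / F\<^sub>\<nu>(z) = G\<^sub>\<nu>(z)\<close>, which is \<open>fls_compose_fps H (cauchy_transform \<nu>)\<close>.
\<close>

definition cauchy_transform :: "(nat \<Rightarrow> complex) \<Rightarrow> complex fps" where
  "cauchy_transform m = fps_X * Abs_fps m"

definition reciprocal_cauchy_transform :: "(nat \<Rightarrow> complex) \<Rightarrow> complex fls" where
  "reciprocal_cauchy_transform m = inverse (fps_to_fls (cauchy_transform m))"


section \<open>Measures with finite moments\<close>

definition finite_moments :: "real measure \<Rightarrow> bool" where
  "finite_moments M \<longleftrightarrow> (\<forall>n. integrable M (\<lambda>x. x ^ n))"

definition moment :: "real measure \<Rightarrow> nat \<Rightarrow> complex" where
  "moment M n = complex_of_real (\<integral>x. x ^ n \<partial>M)"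

end

theory Submission
  imports Defs
begin

text \<open>
  Let \<open>(a, b)\<close> be an orthogonal pair with distributions \<open>m\<close> and \<open>v\<close>, and follow the mixed moments
  \<open>\<phi> (a\<^sup>k (a + b)\<^sup>n)\<close> through their generating functions
  \<open>t\<^sub>k(x) = \<Sum>\<^sub>n \<phi> (a\<^sup>k (a + b)\<^sup>n) x\<^sup>n\<close>. Splitting each word of \<open>(a + b)\<^sup>n\<close> at its first letter \<open>a\<close>
  and applying orthogonality to the power of \<open>b\<close> in front of it gives, with
  \<open>g(x) = x \<Sum>\<^sub>j v\<^sub>j x\<^sup>j\<close> the Cauchy transform of \<open>v\<close> in the variable \<open>x = z\<^sup>-\<^sup>1\<close>,
  \<open>t\<^sub>k = m\<^sub>k (1 - (g - x) t\<^sub>1) + g t\<^sub>k\<^sub>+\<^sub>1\<close>.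
  The factor \<open>c = 1 - (g - x) t\<^sub>1\<close> is independent of \<open>k\<close> and \<open>g\<close> has no constant term, so iterating
  the relation sums it to \<open>t\<^sub>0 = c M(g)\<close>, where \<open>M\<close> is the moment series of \<open>m\<close>.

  Since \<open>t\<^sub>0 = 1 + x t\<^sub>1\<close>, this is an algebraic equation for \<open>t\<^sub>0\<close> alone. In terms of the Cauchy
  transform \<open>G = x t\<^sub>0\<close> of \<open>a + b\<close> and of \<open>h = g M(g)\<close>, the Cauchy transform of \<open>m\<close> after the
  substitution, it says \<open>x g G = h (x g - g G + x G)\<close>. Dividing by \<open>x g G h\<close> yields
  \<open>1/G = 1/h - 1/g + 1/x\<close>, which is the claim because \<open>1/x = z\<close>.
\<close>

text \<open>
  The remainder \<open>g\<^sup>N t\<^sub>N\<close> left after unrolling the recursion \<open>N\<close> times has no coefficients below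
  \<open>N\<close>, whatever \<open>t\<^sub>N\<close> is, so the partial sums of \<open>\<Sum>\<^sub>k m\<^sub>k g\<^sup>k\<close> determine \<open>t\<^sub>0\<close>.
\<close>

lemma fps_compose_eq_recursion:
  fixes g c :: "'a::comm_ring_1 fps"
  assumes g0: "fps_nth g 0 = 0"
    and rec: "\<And>k. t k = fps_const (m k) * c + g * t (Suc k)"
  shows "t 0 = c * fps_compose (Abs_fps m) g"
proof -
  have partial: "t 0 = c * (\<Sum>k<N. fps_const (m k) * g ^ k) + g ^ N * t N" for N
  proof (induction N)
    case (Suc N)
    show ?case
      by (subst Suc.IH, subst rec[of N]) (simp add: algebra_simps)
  qed simp
  have small: "fps_nth (g ^ N) i = 0" if "i < N" for i N
    using startsby_zero_power_prefix[OF g0, of N] that by simp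
  show ?thesis
  proof (rule fps_ext)
    fix n
    have "fps_nth (\<Sum>k<Suc n. fps_const (m k) * g ^ k) i = fps_nth (fps_compose (Abs_fps m) g) i"
      if "i \<le> n" for i
      unfolding fps_sum_nth fps_compose_nth fps_mult_left_const_nth fps_nth_Abs_fps
      by (rule sum.mono_neutral_right) (use that small in auto)
    then have "fps_nth (c * (\<Sum>k<Suc n. fps_const (m k) * g ^ k)) n =
        fps_nth (c * fps_compose (Abs_fps m) g) n"
      unfolding fps_mult_nth by (intro sum.cong) auto
    moreover have "fps_nth (g ^ Suc n * t (Suc n)) n = 0"
      unfolding fps_mult_nth by (intro sum.neutral) (simp add: small del: power_Suc)
    ultimately show "fps_nth (t 0) n = fps_nth (c * fps_compose (Abs_fps m) g) n"
      by (subst partial[of "Suc n"]) (simp only: fps_add_nth add_0_right)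
  qed
qed

definition mixed_moment_series ::
    "('a::complex_algebra_1 \<Rightarrow> complex) \<Rightarrow> 'a \<Rightarrow> 'a \<Rightarrow> nat \<Rightarrow> complex fps" where
  "mixed_moment_series \<phi> a b k = Abs_fps (\<lambda>n. \<phi> (a ^ k * (a + b) ^ n))"

lemma mixed_moment_series_0:
  assumes "normalized_functional \<phi>" and "orthogonal_pair \<phi> \<psi> a b"
  shows "mixed_moment_series \<phi> a b 0 = 1 + fps_X * mixed_moment_series \<phi> a b 1"
proof (rule fps_ext)
  fix n
  show "fps_nth (mixed_moment_series \<phi> a b 0) n =
      fps_nth (1 + fps_X * mixed_moment_series \<phi> a b 1) n"
    using orthogonal_pair_recurrence(1)[OF assms] normalized_functionalD(4)[OF assms(1)]
    by (cases n) (simp_all add: mixed_moment_series_def del: power_Suc)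
qed

text \<open>
  A word \<open>a\<^sup>k b\<^sup>j a w\<close> with \<open>k, j \<ge> 1\<close> contributes \<open>\<psi> (b\<^sup>j)\<close> times
  \<open>\<phi> (a\<^sup>k\<^sup>+\<^sup>1 w) - \<phi> (a\<^sup>k) \<phi> (a w)\<close>, while for \<open>j = 0\<close> only the first summand is present. As
  \<open>\<psi> 1 = 1\<close>, the first summands form the convolution with all moments of \<open>b\<close> and give
  \<open>g t\<^sub>k\<^sub>+\<^sub>1\<close>; the second ones miss the moment of order \<open>0\<close>, whence the factor \<open>g - x\<close> in place of
  \<open>g\<close>. The case \<open>k = 0\<close>, where words starting with \<open>b\<close> vanish, fits the same formula because
  there the two contributions \<open>g t\<^sub>1\<close> cancel.
\<close>

lemma mixed_moment_series_recursion:
  fixes a b :: "'a::complex_algebra_1"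
  assumes nf: "normalized_functional \<phi>" and orth: "orthogonal_pair \<phi> \<psi> a b" and one: "\<psi> 1 = 1"
  defines "g \<equiv> cauchy_transform (distribution_of \<psi> b)" and "t \<equiv> mixed_moment_series \<phi> a b"
  shows "t k = fps_const (\<phi> (a ^ k)) * (1 - (g - fps_X) * t 1) + g * t (Suc k)"
proof (cases k)
  case 0
  show ?thesis
    using mixed_moment_series_0[OF nf orth] normalized_functionalD(4)[OF nf]
    by (simp add: 0 t_def algebra_simps)
next
  case (Suc l)
  define V where "V = Abs_fps (distribution_of \<psi> b)"
  have g: "g = fps_X * V"
    by (simp add: g_def V_def cauchy_transform_def)
  have V: "fps_nth V i = \<psi> (b ^ i)" for i
    by (simp add: V_def distribution_of_def)
  have t: "fps_nth (t i) n = \<phi> (a ^ i * (a + b) ^ n)" for i n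
    by (simp add: t_def mixed_moment_series_def)
  \<comment> \<open>Subtracting \<open>1\<close> from \<open>V\<close> removes the term \<open>j = 0\<close> from the second convolution.\<close>
  have "t k = fps_const (\<phi> (a ^ k))
      + fps_X * (V * t (Suc k) - fps_const (\<phi> (a ^ k)) * ((V - 1) * t 1))"
  proof (rule fps_ext)
    fix n
    show "fps_nth (t k) n = fps_nth (fps_const (\<phi> (a ^ k))
      + fps_X * (V * t (Suc k) - fps_const (\<phi> (a ^ k)) * ((V - 1) * t 1))) n"
    proof (cases n)
      case 0
      then show ?thesis by (simp add: t)
    next
      case n: (Suc n')
      have "fps_nth (t k) n = (\<Sum>j<Suc n'. if j = 0 then \<phi> (a ^ Suc k * (a + b) ^ n')
         else \<psi> (b ^ j) * (\<phi> (a ^ Suc k * (a + b) ^ (n' - j))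
                 - \<phi> (a ^ k) * \<phi> (a * (a + b) ^ (n' - j))))"
        unfolding t n Suc by (rule orthogonal_pair_recurrence(2)[OF nf orth])
      also have "\<dots> = (\<Sum>j=0..n'. fps_nth V j * fps_nth (t (Suc k)) (n' - j)
          - \<phi> (a ^ k) * (fps_nth (V - 1) j * fps_nth (t 1) (n' - j)))"
        by (rule sum.cong) (auto simp: t V one algebra_simps)
      also have "\<dots> = fps_nth (V * t (Suc k) - fps_const (\<phi> (a ^ k)) * ((V - 1) * t 1)) n'"
        unfolding fps_sub_nth[of "V * t (Suc k)"] fps_mult_left_const_nth
        by (simp only: fps_mult_nth sum_subtractf sum_distrib_left)
      finally show ?thesis by (simp add: n)
    qed
  qed
  then show ?thesis
    by (simp add: g algebra_simps)
qed

text \<open>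
  By definition the convolution is realized by an orthogonal pair, so the summed recursion applies;
  the remainder is the elimination of \<open>t\<^sub>1\<close> from the two equations for \<open>t\<^sub>0\<close>.
\<close>

lemma reciprocal_cauchy_transform_orthogonal_convolution:
  fixes m v :: "nat \<Rightarrow> complex"
  assumes m: "m 0 = 1" and v: "v 0 = 1"
  shows "reciprocal_cauchy_transform (m \<turnstile> v) =
    fls_compose_fps (reciprocal_cauchy_transform m) (cauchy_transform v)
      - reciprocal_cauchy_transform v + fls_X_inv"
proof -
  have "is_orthogonal_convolution m v (m \<turnstile> v)"
    unfolding orthogonal_convolution_def
    by (rule theI'[OF orthogonal_convolution_unique[where m = m and v = v, OF m v]])
  then obtain \<phi> \<psi> and a b :: free_algebra where
    nf: "normalized_functional \<phi>" "normalized_functional \<psi>" and orth: "orthogonal_pair \<phi> \<psi> a b"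
    and da: "distribution_of \<phi> a = m" and db: "distribution_of \<psi> b = v"
    and dr: "distribution_of \<phi> (a + b) = m \<turnstile> v"
    unfolding is_orthogonal_convolution_def by blast
  define t where "t = mixed_moment_series \<phi> a b"
  define g where "g = cauchy_transform v"
  define G where "G = cauchy_transform (m \<turnstile> v)"
  define h where "h = fps_compose (cauchy_transform m) g"
  have g0: "fps_nth g 0 = 0" and nz: "g \<noteq> 0"
    using v by (auto simp: g_def cauchy_transform_def fps_eq_iff intro!: exI[of _ 1])
  have ma: "\<phi> (a ^ k) = m k" for k
    using fun_cong[OF da, of k] by (simp add: distribution_of_def)
  have G: "G = fps_X * t 0"
    using dr by (simp add: G_def cauchy_transform_def t_def mixed_moment_series_def
        distribution_of_def fun_eq_iff)
  have t01: "t 0 = 1 + fps_X * t 1"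
    unfolding t_def by (rule mixed_moment_series_0[OF nf(1) orth])
  have "t k = fps_const (m k) * (1 - (g - fps_X) * t 1) + g * t (Suc k)" for k
    using mixed_moment_series_recursion[OF nf(1) orth normalized_functionalD(4)[OF nf(2)], of k]
    by (simp only: ma db t_def g_def)
  from fps_compose_eq_recursion[OF g0, of t, OF this]
  have t0: "t 0 = (1 - (g - fps_X) * t 1) * fps_compose (Abs_fps m) g" .
  have h: "h = g * fps_compose (Abs_fps m) g"
    unfolding h_def cauchy_transform_def
    by (simp add: fps_compose_mult_distrib[OF g0] fps_X_fps_compose_startby0[OF g0])
  \<comment> \<open>The equation is kept free of divisions, as none of \<open>x\<close>, \<open>g\<close>, \<open>G\<close>, \<open>h\<close> is invertible among
      power series; it is divided by \<open>x g G h\<close> in the field of Laurent series.\<close>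
  have "fps_X * g * G = fps_X * fps_X * g * t 0"
    by (simp add: G)
  also have "\<dots> = h * (fps_X * fps_X - (g - fps_X) * fps_X * (fps_X * t 1))"
    by (subst t0) (simp add: h algebra_simps)
  also have "\<dots> = h * (fps_X * g - g * G + fps_X * G)"
    by (simp add: G t01 algebra_simps)
  finally have eq: "fps_X * g * G = h * (fps_X * g - g * G + fps_X * G)" .
  have "fps_nth (t 0) 0 = 1"
    by (simp add: t01)
  then have G_nz: "G \<noteq> 0"
    by (auto simp: G)
  then have h_nz: "h \<noteq> 0"
    using eq nz by auto
  let ?l = fps_to_fls
  have leq: "fls_X * ?l g * ?l G = ?l h * (fls_X * ?l g - ?l g * ?l G + fls_X * ?l G)"
    using arg_cong[OF eq, of ?l]
    by (simp add: fls_times_fps_to_fls)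
  have "inverse (?l G) = inverse (?l h) - inverse (?l g) + inverse fls_X"
  proof -
    \<comment> \<open>For arbitrary field elements, since rules for \<open>fls_X\<close> would turn its products and its
        inverse into shifts.\<close>
    have "inverse G' = inverse h' - inverse g' + inverse x"
      if "x * g' * G' = h' * (x * g' - g' * G' + x * G')" "x \<noteq> 0" "g' \<noteq> 0" "G' \<noteq> 0" "h' \<noteq> 0"
      for x g' G' h' :: "complex fls"
      using that by (simp add: field_simps)
    from this[OF leq] show ?thesis
      using G_nz h_nz nz by simp
  qed
  moreover have "fls_compose_fps (reciprocal_cauchy_transform m) g = inverse (?l h)"
    unfolding reciprocal_cauchy_transform_def h_def
    using g0 nz by (simp add: fls_compose_fps_inverse fls_compose_fps_to_fls)
  ultimately show ?thesis
    by (simp add: reciprocal_cauchy_transform_def G_def g_def fls_inverse_X)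
qed

lemma moment_0:
  assumes "prob_space M"
  shows "moment M 0 = 1"
  using prob_space.prob_space[OF assms] by (simp add: moment_def)

theorem theorem6p2:
  fixes \<mu> \<nu> :: "real measure"
  assumes "real_distribution \<mu>" and "finite_moments \<mu>"
    and "real_distribution \<nu>" and "finite_moments \<nu>"
  shows "reciprocal_cauchy_transform (moment \<mu> \<turnstile> moment \<nu>) =
    fls_compose_fps (reciprocal_cauchy_transform (moment \<mu>)) (cauchy_transform (moment \<nu>))
      - reciprocal_cauchy_transform (moment \<nu>) + fls_X_inv"
  using assms
  by (intro reciprocal_cauchy_transform_orthogonal_convolution moment_0 real_distribution.axioms(1))

end
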